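(* Let $\{e_j\}_{j\ge1}$ be an orthonormal basis of $L^2_Z$, let $\gamma=(\gamma_j)_{j\ge1}$, $\omega=(\omega_j)_{j\ge1}$, $\upsilon=(\upsilon_j)_{j\ge1}$ be weight sequences satisfying the regularity assumption (R) of the context, and let $\rho,\tau>0$, $d\ge1$, $\eta\ge1$. Suppose that the conditional expectation operator $T$ associated with $(Z,W)$ belongs to $\mathcal T_\upsilon^d$ and that $\sup_{j\ge1}\mathbb E[e_j^4(Z)\mid W]\le\eta$. Then for all sufficiently large $\sigma>0$ (with a threshold not depending on $n$) the following holds. Let $n\ge1$, $\triangle\ge1$, and let $m_*=m_*(n)\in\mathbb N$ and $\delta_*=\delta_*(n)>0$ be such that $$\frac1\triangle\le\frac{\gamma_{m_*}}{n\,\upsilon_{m_*}}\le\triangle\qquad\text{and}\qquad\delta_*:=\gamma_{m_*}^{-1}\omega_{m_*}^{-1}.$$ Then for any estimator $\breve\ell$ based on an i.i.d. $n$-sample of $(Y,Z,W)$ with $Y=\varphi(Z)+U$, $$\sup_{U\in\mathcal U_\sigma}\ \sup_{\varphi\in\mathcal F_\gamma^\rho}\ \sup_{h\in\mathcal F_\omega^\tau}\mathbb E|\breve\ell-\ell_h(\varphi)|^2\ \ge\ \max\Bigl(\delta_*,\frac1n\Bigr)\,\frac{\tau}{4\triangle}\,\min\Bigl(\frac{1}{2d},\frac{\rho}{\triangle}\Bigr).$$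
   Context: Model: $Y=\varphi(Z)+U$ with $\mathbb E[U\mid W]=0$, where $Y$ is real-valued, $Z$ takes values in $\mathbb R^p$ and $W$ in $\mathbb R^q$. $L^2_Z=\{\phi:\mathbb R^p\to\mathbb R:\ \|\phi\|_Z^2:=\mathbb E[\phi^2(Z)]<\infty\}$ with $\langle\phi,\tilde\phi\rangle_Z=\mathbb E[\phi(Z)\tilde\phi(Z)]$; $L^2_W$, $\|\cdot\|_W$, $\langle\cdot,\cdot\rangle_W$ are defined analogously with $W$. The conditional expectation operator is $T:L^2_Z\to L^2_W$, $T\phi=\mathbb E[\phi(Z)\mid W]$. For $h\in L^2_Z$, $\ell_h(\varphi):=\langle h,\varphi\rangle_Z=\mathbb E[h(Z)\varphi(Z)]$. For a strictly positive weight sequence $w$: $\|\phi\|_w^2:=\sum_{j\ge1}w_j|\langle\phi,e_j\rangle_Z|^2$ and $\mathcal F_w^c:=\{\phi\in L^2_Z:\|\phi\|_w^2\le c\}$. $\mathcal T_\upsilon^d$ is the set of injective compact operators $T:L^2_Z\to L^2_W$ with $\|\phi\|_\upsilon^2/d\le\|T\phi\|_W^2\le d\|\phi\|_\upsilon^2$ for all $\phi\in L^2_Z$. $\mathcal U_\sigma:=\{U:\ \mathbb E[U\mid W]=0,\ \mathbb E[U^4\mid W]\le\sigma^4\}$. The law of $(Z,W)$ is fixed, and $U$ ranges over all error terms jointly distributed with $(Z,W)$ (on a possibly enlarged probability space) satisfying these constraints. Regularity assumption (R): $\gamma,\omega,\upsilon$ are strictly positive with $\gamma_1=\omega_1=\upsilon_1=1$;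 $\gamma$ and $\omega$ are non-decreasing, $\upsilon$ is non-increasing; and there is a constant $\Lambda\ge1$ such that $\upsilon_m\sup_{1\le j\le m}\{\upsilon_j^{-1}\omega_j^{-1}\}\le\Lambda\max(\omega_m^{-1},\upsilon_m)$ for all $m\in\mathbb N$. An estimator is a measurable function of the sample $(Y_i,Z_i,W_i)_{i=1}^n$ (it may depend on the known representer $h$). *)

theory Defs
  imports "HOL-Probability.Probability"
begin

text \<open>
  For a random vector \<open>X\<close> on \<open>M\<close>, an element of \<open>L\<^sup>2\<^sub>X\<close> is represented by a measurable function on the
  range of \<open>X\<close>; two representatives of the same class agree almost surely at \<open>X\<close>.
  All sequences (weights, basis) are indexed by \<open>j \<ge> 1\<close>; their value at \<open>0\<close> is never used.
\<close>

definition L2 :: "'a measure \<Rightarrow> ('a \<Rightarrow> 'b::euclidean_space) \<Rightarrow> ('b \<Rightarrow> real) set" where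
  "L2 M X = {\<phi> \<in> borel_measurable borel. integrable M (\<lambda>x. (\<phi> (X x))\<^sup>2)}"

definition inner_L2 ::
  "'a measure \<Rightarrow> ('a \<Rightarrow> 'b::euclidean_space) \<Rightarrow> ('b \<Rightarrow> real) \<Rightarrow> ('b \<Rightarrow> real) \<Rightarrow> real" where
  "inner_L2 M X \<phi> \<psi> = (\<integral>x. \<phi> (X x) * \<psi> (X x) \<partial>M)"

definition norm_L2 :: "'a measure \<Rightarrow> ('a \<Rightarrow> 'b::euclidean_space) \<Rightarrow> ('b \<Rightarrow> real) \<Rightarrow> real" where
  "norm_L2 M X \<phi> = sqrt (inner_L2 M X \<phi> \<phi>)"

definition orthonormal_basis ::
  "'a measure \<Rightarrow> ('a \<Rightarrow> 'b::euclidean_space) \<Rightarrow> (nat \<Rightarrow> 'b \<Rightarrow> real) \<Rightarrow> bool" where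
  "orthonormal_basis M X e \<longleftrightarrow>
     (\<forall>j\<ge>1. e j \<in> L2 M X) \<and>
     (\<forall>i\<ge>1. \<forall>j\<ge>1. inner_L2 M X (e i) (e j) = (if i = j then 1 else 0)) \<and>
     (\<forall>\<phi>\<in>L2 M X.
        (\<lambda>N. norm_L2 M X (\<lambda>z. \<phi> z - (\<Sum>j=1..N. inner_L2 M X \<phi> (e j) * e j z)))
          \<longlonglongrightarrow> 0)"

text \<open>The squared weighted norm takes the value \<open>\<infinity>\<close> when the series diverges.\<close>

definition wnorm_sq ::
  "'a measure \<Rightarrow> ('a \<Rightarrow> 'b::euclidean_space) \<Rightarrow> (nat \<Rightarrow> 'b \<Rightarrow> real) \<Rightarrow> (nat \<Rightarrow> real)
     \<Rightarrow> ('b \<Rightarrow> real) \<Rightarrow> ennreal" where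
  "wnorm_sq M X e w \<phi> =
     (\<Sum>j. ennreal (w (Suc j) * \<bar>inner_L2 M X \<phi> (e (Suc j))\<bar>\<^sup>2))"

definition ellipsoid ::
  "'a measure \<Rightarrow> ('a \<Rightarrow> 'b::euclidean_space) \<Rightarrow> (nat \<Rightarrow> 'b \<Rightarrow> real) \<Rightarrow> (nat \<Rightarrow> real)
     \<Rightarrow> real \<Rightarrow> ('b \<Rightarrow> real) set" where
  "ellipsoid M X e w c = {\<phi> \<in> L2 M X. wnorm_sq M X e w \<phi> \<le> ennreal c}"

definition sigma_gen :: "'a measure \<Rightarrow> ('a \<Rightarrow> 'b::euclidean_space) \<Rightarrow> 'a measure" where
  "sigma_gen M X = vimage_algebra (space M) X borel"

text \<open>\<open>T \<phi>\<close> is, for every \<open>\<phi>\<close>, some version of \<open>E[\<phi>(Z) | W]\<close> written as a function of \<open>W\<close>.\<close>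

definition cond_exp_operator ::
  "'a measure \<Rightarrow> ('a \<Rightarrow> 'b::euclidean_space) \<Rightarrow> ('a \<Rightarrow> 'c::euclidean_space)
     \<Rightarrow> (('b \<Rightarrow> real) \<Rightarrow> ('c \<Rightarrow> real)) \<Rightarrow> bool" where
  "cond_exp_operator M Z W T \<longleftrightarrow>
     (\<forall>\<phi>\<in>L2 M Z. T \<phi> \<in> L2 M W \<and>
        (AE x in M. T \<phi> (W x) = real_cond_exp M (sigma_gen M W) (\<lambda>x. \<phi> (Z x)) x))"

definition linear_L2 ::
  "'a measure \<Rightarrow> ('a \<Rightarrow> 'b::euclidean_space) \<Rightarrow> ('a \<Rightarrow> 'c::euclidean_space)
     \<Rightarrow> (('b \<Rightarrow> real) \<Rightarrow> ('c \<Rightarrow> real)) \<Rightarrow> bool" where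
  "linear_L2 M Z W T \<longleftrightarrow>
     (\<forall>\<phi>\<in>L2 M Z. T \<phi> \<in> L2 M W) \<and>
     (\<forall>\<phi>\<in>L2 M Z. \<forall>\<psi>\<in>L2 M Z. \<forall>a b. AE x in M.
        T (\<lambda>z. a * \<phi> z + b * \<psi> z) (W x) = a * T \<phi> (W x) + b * T \<psi> (W x))"

definition injective_L2 ::
  "'a measure \<Rightarrow> ('a \<Rightarrow> 'b::euclidean_space) \<Rightarrow> ('a \<Rightarrow> 'c::euclidean_space)
     \<Rightarrow> (('b \<Rightarrow> real) \<Rightarrow> ('c \<Rightarrow> real)) \<Rightarrow> bool" where
  "injective_L2 M Z W T \<longleftrightarrow>
     (\<forall>\<phi>\<in>L2 M Z. \<forall>\<psi>\<in>L2 M Z.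
        (AE x in M. T \<phi> (W x) = T \<psi> (W x)) \<longrightarrow> (AE x in M. \<phi> (Z x) = \<psi> (Z x)))"

definition compact_L2 ::
  "'a measure \<Rightarrow> ('a \<Rightarrow> 'b::euclidean_space) \<Rightarrow> ('a \<Rightarrow> 'c::euclidean_space)
     \<Rightarrow> (('b \<Rightarrow> real) \<Rightarrow> ('c \<Rightarrow> real)) \<Rightarrow> bool" where
  "compact_L2 M Z W T \<longleftrightarrow>
     (\<forall>f :: nat \<Rightarrow> 'b \<Rightarrow> real. (\<forall>k. f k \<in> L2 M Z) \<and> (\<exists>B. \<forall>k. norm_L2 M Z (f k) \<le> B) \<longrightarrow>
        (\<exists>r g. strict_mono r \<and> g \<in> L2 M W \<and>
           (\<lambda>k. norm_L2 M W (\<lambda>w. T (f (r k)) w - g w)) \<longlonglongrightarrow> 0))"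

definition op_class ::
  "'a measure \<Rightarrow> ('a \<Rightarrow> 'b::euclidean_space) \<Rightarrow> ('a \<Rightarrow> 'c::euclidean_space)
     \<Rightarrow> (nat \<Rightarrow> 'b \<Rightarrow> real) \<Rightarrow> (nat \<Rightarrow> real) \<Rightarrow> real
     \<Rightarrow> (('b \<Rightarrow> real) \<Rightarrow> ('c \<Rightarrow> real)) set" where
  "op_class M Z W e \<upsilon> d =
     {T. linear_L2 M Z W T \<and> injective_L2 M Z W T \<and> compact_L2 M Z W T \<and>
         (\<forall>\<phi>\<in>L2 M Z.
            wnorm_sq M Z e \<upsilon> \<phi> / ennreal d \<le> ennreal ((norm_L2 M W (T \<phi>))\<^sup>2) \<and>
            ennreal ((norm_L2 M W (T \<phi>))\<^sup>2) \<le> ennreal d * wnorm_sq M Z e \<upsilon> \<phi>)}"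

definition regular_weights :: "(nat \<Rightarrow> real) \<Rightarrow> (nat \<Rightarrow> real) \<Rightarrow> (nat \<Rightarrow> real) \<Rightarrow> bool" where
  "regular_weights \<gamma> \<omega> \<upsilon> \<longleftrightarrow>
     (\<forall>j\<ge>1. 0 < \<gamma> j \<and> 0 < \<omega> j \<and> 0 < \<upsilon> j) \<and>
     \<gamma> 1 = 1 \<and> \<omega> 1 = 1 \<and> \<upsilon> 1 = 1 \<and>
     mono_on {1..} \<gamma> \<and> mono_on {1..} \<omega> \<and> antimono_on {1..} \<upsilon> \<and>
     (\<exists>\<Lambda>\<ge>1. \<forall>m\<ge>1.
        \<upsilon> m * (SUP j\<in>{1..m}. inverse (\<upsilon> j) * inverse (\<omega> j)) \<le> \<Lambda> * max (inverse (\<omega> m)) (\<upsilon> m))"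

definition error_term :: "'a measure \<Rightarrow> ('a \<Rightarrow> 'c::euclidean_space) \<Rightarrow> real \<Rightarrow> ('a \<Rightarrow> real) \<Rightarrow> bool"
  where
  "error_term N W \<sigma> U \<longleftrightarrow>
     integrable N U \<and>
     (AE x in N. real_cond_exp N (sigma_gen N W) U x = 0) \<and>
     (AE x in N. nn_cond_exp N (sigma_gen N W) (\<lambda>x. ennreal (U x ^ 4)) x \<le> ennreal (\<sigma> ^ 4))"

text \<open>
  An error term, possibly living on an enlarged probability space, enters the risk only through the
  joint law of \<open>(U, Z, W)\<close>. Hence the class of error terms is represented by the set of all
  Borel probability measures on triples \<open>(u, z, w)\<close> whose \<open>(z, w)\<close>-marginal is the given law of
  \<open>(Z, W)\<close> and whose coordinate \<open>u\<close> satisfies the moment conditions given the coordinate \<open>w\<close>.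
\<close>

definition error_laws ::
  "'a measure \<Rightarrow> ('a \<Rightarrow> 'b::euclidean_space) \<Rightarrow> ('a \<Rightarrow> 'c::euclidean_space) \<Rightarrow> real
     \<Rightarrow> (real \<times> 'b \<times> 'c) measure set" where
  "error_laws M Z W \<sigma> =
     {Q. prob_space Q \<and> sets Q = sets borel \<and>
         distr Q borel (\<lambda>(u, z, w). (z, w)) = distr M borel (\<lambda>x. (Z x, W x)) \<and>
         error_term Q (\<lambda>(u, z, w). w) \<sigma> (\<lambda>(u, z, w). u)}"

definition obs_law ::
  "(real \<times> 'b::euclidean_space \<times> 'c::euclidean_space) measure \<Rightarrow> ('b \<Rightarrow> real)
     \<Rightarrow> (real \<times> 'b \<times> 'c) measure" where
  "obs_law Q \<phi> = distr Q borel (\<lambda>(u, z, w). (\<phi> z + u, z, w))"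

definition estimators ::
  "nat \<Rightarrow> ((nat \<Rightarrow> real \<times> 'b::euclidean_space \<times> 'c::euclidean_space) \<Rightarrow> real) set" where
  "estimators n = borel_measurable (Pi\<^sub>M {1..n} (\<lambda>_. borel))"

definition risk ::
  "nat \<Rightarrow> (real \<times> 'b::euclidean_space \<times> 'c::euclidean_space) measure
     \<Rightarrow> ((nat \<Rightarrow> real \<times> 'b \<times> 'c) \<Rightarrow> real) \<Rightarrow> real \<Rightarrow> ennreal" where
  "risk n P est l = (\<integral>\<^sup>+ s. ennreal (\<bar>est s - l\<bar>\<^sup>2) \<partial>(Pi\<^sub>M {1..n} (\<lambda>_. P)))"

end

theory Submission
  imports Defs
begin

text \<open>
  The bound is a two-point argument in one basis direction \<open>e j\<close> at a time, once with \<open>j = m\<close>, which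
  gives the rate \<open>\<delta>\<close>, and once with \<open>j = 1\<close>, which gives the parametric rate \<open>1 / n\<close>.

  The two hypotheses are \<open>\<phi> = s * e j\<close> with \<open>s = \<plusminus> sqrt A\<close>, and the functional is represented by
  \<open>h = sqrt B * e j\<close>, so that the values to be estimated are \<open>\<plusminus> sqrt (A * B)\<close>. With \<open>g = T (e j)\<close>
  and a standard Gaussian \<open>\<epsilon>\<close> independent of \<open>(Z, W)\<close>, the error \<open>U = s * (g W - e j Z) + \<epsilon>\<close>
  is admissible: it is centred given \<open>W\<close> because \<open>g W\<close> is the conditional expectation of \<open>e j Z\<close>,
  and its conditional fourth moment is controlled by \<open>\<eta>\<close>, since Jensen's inequality carries the
  bound on \<open>E[(e j Z)^4 | W]\<close> over to \<open>(g W)^4\<close> (lemma \<open>gauss_law_error_law\<close>). As \<open>A \<le> 1\<close>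
  throughout and \<open>\<sigma>\<close> enters only here, its threshold depends on \<open>\<eta>\<close> alone.

  The endogenous part of the error cancels in \<open>Y = \<phi> Z + U = s * g W + \<epsilon>\<close>. The data thus see
  \<open>\<phi>\<close> only through \<open>T \<phi>\<close>, whose squared norm is at most \<open>d * \<upsilon> j * A\<close>. Relative to the law with
  \<open>s = 0\<close> the two laws of the sample have explicit densities \<open>L\<close> and \<open>L'\<close>, and \<open>sqrt (L * L')\<close> is
  simply the product of the factors \<open>exp (- (s * g W)\<^sup>2 / 2)\<close>. Its integral, the Hellinger affinity of
  the two laws, is at least \<open>3/4\<close> when \<open>n * d * \<upsilon> j * A \<le> 1/2\<close>; in that case no estimator can have
  small risk at both points (lemmas \<open>two_point_risk\<close> and \<open>gauss_law_two_point_risk\<close>). Because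
  \<open>n * \<upsilon> m \<le> \<Delta> * \<gamma> m\<close>, this condition is met by some \<open>A\<close> of the order of \<open>1 / \<gamma> m\<close>, the largest order
  that the ellipsoid of \<open>\<phi>\<close> allows; together with \<open>B = \<tau> / \<omega> m\<close> this gives the rate \<open>\<delta>\<close>. For \<open>j = 1\<close>,
  where all weights are \<open>1\<close>, the condition is met by some \<open>A\<close> of the order of \<open>1 / n\<close>.
\<close>

section \<open>Product measures and conditional expectations\<close>

lemma PiM_density:
  fixes P :: "'i \<Rightarrow> 'a measure" and L :: "'i \<Rightarrow> 'a \<Rightarrow> ennreal"
  assumes "finite I"
    and P: "\<And>i. prob_space (P i)"
    and L[measurable]: "\<And>i. L i \<in> borel_measurable (P i)"
    and D: "\<And>i. prob_space (density (P i) (L i))"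
  shows "(\<Pi>\<^sub>M i\<in>I. density (P i) (L i)) = density (\<Pi>\<^sub>M i\<in>I. P i) (\<lambda>x. \<Prod>i\<in>I. L i (x i))"
proof -
  interpret P: product_sigma_finite P
    using P by (simp add: product_sigma_finite_def prob_space_imp_sigma_finite)
  interpret D: product_sigma_finite "\<lambda>i. density (P i) (L i)"
    using D by (simp add: product_sigma_finite_def prob_space_imp_sigma_finite)
  show ?thesis
  proof (rule D.PiM_eqI[symmetric, OF \<open>finite I\<close>])
    show "sets (density (Pi\<^sub>M I P) (\<lambda>x. \<Prod>i\<in>I. L i (x i)))
        = sets (\<Pi>\<^sub>M i\<in>I. density (P i) (L i))"
      by (auto intro!: sets_PiM_cong)
    fix A assume A: "\<And>i. i \<in> I \<Longrightarrow> A i \<in> sets (density (P i) (L i))"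
    then have [measurable]: "Pi\<^sub>E I A \<in> sets (Pi\<^sub>M I P)"
      using \<open>finite I\<close> by (intro sets_PiM_I_finite) auto
    have "emeasure (density (Pi\<^sub>M I P) (\<lambda>x. \<Prod>i\<in>I. L i (x i))) (Pi\<^sub>E I A)
        = (\<integral>\<^sup>+x. (\<Prod>i\<in>I. L i (x i)) * indicator (Pi\<^sub>E I A) x \<partial>Pi\<^sub>M I P)"
      by (intro emeasure_density) measurable
    also have "\<dots> = (\<integral>\<^sup>+x. (\<Prod>i\<in>I. L i (x i) * indicator (A i) (x i)) \<partial>Pi\<^sub>M I P)"
    proof (intro nn_integral_cong)
      fix x assume "x \<in> space (Pi\<^sub>M I P)"
      then have "x \<in> extensional I"
        by (simp add: space_PiM PiE_def)
      then have "(indicator (Pi\<^sub>E I A) x :: ennreal) = (\<Prod>i\<in>I. indicator (A i) (x i))"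
        using \<open>finite I\<close> by (induction rule: infinite_finite_induct)
          (auto simp: indicator_def PiE_iff prod.If_cases split: if_splits)
      then show "(\<Prod>i\<in>I. L i (x i)) * indicator (Pi\<^sub>E I A) x
          = (\<Prod>i\<in>I. L i (x i) * indicator (A i) (x i))"
        by (simp add: prod.distrib)
    qed
    also have "\<dots> = (\<Prod>i\<in>I. \<integral>\<^sup>+x. L i x * indicator (A i) x \<partial>P i)"
      using A by (intro P.product_nn_integral_prod[OF \<open>finite I\<close>]) (auto intro!: borel_measurable_times_ennreal L)
    also have "\<dots> = (\<Prod>i\<in>I. emeasure (density (P i) (L i)) (A i))"
      using A by (intro prod.cong refl emeasure_density[symmetric]) auto
    finally show "emeasure (density (Pi\<^sub>M I P) (\<lambda>x. \<Prod>i\<in>I. L i (x i))) (Pi\<^sub>E I A)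
        = (\<Prod>i\<in>I. emeasure (density (P i) (L i)) (A i))" .
  qed
qed

text \<open>
  The set where the conditional expectation exceeds \<open>C\<close> is itself an event of the subalgebra;
  the hypothesis for this one event forces it to be null.
\<close>

lemma (in finite_measure_subalgebra) nn_cond_exp_le_const:
  fixes C :: ennreal
  assumes [measurable]: "f \<in> borel_measurable M" and "C < \<infinity>"
    and le: "\<And>A. A \<in> sets F \<Longrightarrow> (\<integral>\<^sup>+x\<in>A. f x \<partial>M) \<le> C * emeasure M A"
  shows "AE x in M. nn_cond_exp M F f x \<le> C"
proof (rule ccontr)
  let ?E = "nn_cond_exp M F f"
  assume neg: "\<not> (AE x in M. ?E x \<le> C)"
  define A where "A = {x \<in> space F. C < ?E x}"
  have [measurable]: "A \<in> sets F"
    unfolding A_def by measurable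
  have AM[measurable]: "A \<in> sets M"
    using subalg \<open>A \<in> sets F\<close> by (auto simp: subalgebra_def)
  have spF: "space F = space M"
    using subalg by (simp add: subalgebra_def)
  have fin: "C * emeasure M A < \<infinity>"
    using \<open>C < \<infinity>\<close> emeasure_finite[of A] by (auto simp: less_top[symmetric] ennreal_mult_eq_top_iff)
  have "C * emeasure M A = (\<integral>\<^sup>+x\<in>A. C \<partial>M)"
    by (simp add: nn_integral_cmult_indicator)
  also have "\<dots> < (\<integral>\<^sup>+x\<in>A. ?E x \<partial>M)"
  proof (rule nn_integral_less)
    show "(\<integral>\<^sup>+x\<in>A. C \<partial>M) \<noteq> \<infinity>"
      using fin by (simp add: nn_integral_cmult_indicator)
    show "AE x in M. C * indicator A x \<le> ?E x * indicator A x"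
      by (auto simp: A_def indicator_def)
    show "\<not> (AE x in M. ?E x * indicator A x \<le> C * indicator A x)"
    proof
      assume "AE x in M. ?E x * indicator A x \<le> C * indicator A x"
      then have "AE x in M. ?E x \<le> C"
        using AE_space
        by eventually_elim (auto simp: A_def indicator_def spF of_bool_def not_less[symmetric] split: if_splits)
      with neg show False by simp
    qed
  qed measurable
  also have "\<dots> = (\<integral>\<^sup>+x. indicator A x * ?E x \<partial>M)"
    by (simp add: mult.commute)
  also have "\<dots> = (\<integral>\<^sup>+x. indicator A x * f x \<partial>M)"
    by (intro nn_cond_exp_intg) measurable
  also have "\<dots> = (\<integral>\<^sup>+x\<in>A. f x \<partial>M)"
    by (simp add: mult.commute)
  also have "\<dots> \<le> C * emeasure M A"
    by (intro le) measurable
  finally show False by simp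
qed

lemma convex_on_power4: "convex_on UNIV (\<lambda>x::real. x ^ 4)"
  by (rule convex_on_realI[where f' = "\<lambda>x. 4 * x ^ 3"])
     (auto intro!: derivative_eq_intros power_mono_odd)

lemma power4_sum3_le: "(x + y + z :: real) ^ 4 \<le> 27 * (x ^ 4 + y ^ 4 + z ^ 4)"
proof -
  have sq3: "(p + q + r :: real)\<^sup>2 \<le> 3 * (p\<^sup>2 + q\<^sup>2 + r\<^sup>2)" for p q r
    using zero_le_power2[of "p - q"] zero_le_power2[of "q - r"] zero_le_power2[of "p - r"]
    by (simp add: power2_eq_square algebra_simps)
  have "(x + y + z) ^ 4 = ((x + y + z)\<^sup>2)\<^sup>2"
    by (simp add: power_mult[symmetric])
  also have "\<dots> \<le> (3 * (x\<^sup>2 + y\<^sup>2 + z\<^sup>2))\<^sup>2"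
    by (intro power_mono sq3) auto
  also have "\<dots> = 9 * (x\<^sup>2 + y\<^sup>2 + z\<^sup>2)\<^sup>2"
    by (simp only: power_mult_distrib) simp
  also have "\<dots> \<le> 9 * (3 * ((x\<^sup>2)\<^sup>2 + (y\<^sup>2)\<^sup>2 + (z\<^sup>2)\<^sup>2))"
    by (intro mult_left_mono sq3) auto
  finally show ?thesis
    by (simp add: power_mult[symmetric])
qed

text \<open>
  Jensen's inequality. The hypothesis on the conditional fourth moment also supplies the integrability
  of \<open>f^4\<close>, so that the real-valued conditional expectation of \<open>f^4\<close> is meaningful.
\<close>

lemma (in finite_measure_subalgebra) cond_exp_power4_le:
  assumes f: "integrable M f"
    and c: "AE x in M. nn_cond_exp M F (\<lambda>x. ennreal (f x ^ 4)) x \<le> ennreal c" and "0 \<le> c"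
  shows "AE x in M. real_cond_exp M F f x ^ 4 \<le> c"
proof -
  have [measurable]: "f \<in> borel_measurable M"
    using f by simp
  let ?E = "nn_cond_exp M F (\<lambda>x. ennreal (f x ^ 4))"
  have "(\<integral>\<^sup>+x. ennreal (f x ^ 4) \<partial>M) = (\<integral>\<^sup>+x. 1 * ennreal (f x ^ 4) \<partial>M)"
    by simp
  also have "\<dots> = (\<integral>\<^sup>+x. 1 * ?E x \<partial>M)"
    by (intro nn_cond_exp_intg[symmetric]) measurable
  also have "\<dots> \<le> (\<integral>\<^sup>+x. ennreal c \<partial>M)"
    using c by (intro nn_integral_mono_AE) auto
  also have "\<dots> < \<infinity>"
    using emeasure_finite[of "space M"] by (auto simp: less_top[symmetric] ennreal_mult_eq_top_iff)
  finally have "integrable M (\<lambda>x. f x ^ 4)"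
    by (intro integrableI_nonneg) auto
  then have "AE x in M. real_cond_exp M F f x ^ 4 \<le> real_cond_exp M F (\<lambda>x. f x ^ 4) x"
    by (intro real_cond_exp_jensens_inequality(2)[where I = UNIV, OF f])
       (auto intro: convex_on_power4)
  then show ?thesis
    using c
  proof eventually_elim
    case (elim x)
    have "real_cond_exp M F (\<lambda>x. f x ^ 4) x \<le> enn2real (?E x)"
      by (simp add: real_cond_exp_def)
    also have "\<dots> \<le> c"
      using enn2real_mono[OF elim(2)] \<open>0 \<le> c\<close> by simp
    finally show ?case
      using elim(1) by simp
  qed
qed

lemma finite_measure_subalgebra_sigma_gen:
  assumes "finite_measure M" and [measurable]: "X \<in> borel_measurable M"
  shows "finite_measure_subalgebra M (sigma_gen M X)"
proof -
  interpret finite_measure M by fact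
  have "subalgebra M (sigma_gen M X)"
    unfolding subalgebra_def sigma_gen_def
    by (auto simp: sets_vimage_algebra2)
  then show ?thesis
    by unfold_locales
qed

lemma sets_sigma_gen:
  "sets (sigma_gen M X) = {X -` B \<inter> space M | B. B \<in> sets borel}"
  by (simp add: sigma_gen_def sets_vimage_algebra2)

section \<open>Gaussian observations\<close>

definition std_gauss :: "real measure" where
  "std_gauss = density lborel std_normal_density"

lemma sets_std_gauss[simp, measurable_cong]: "sets std_gauss = sets borel"
  by (simp add: std_gauss_def)

lemma space_std_gauss[simp]: "space std_gauss = UNIV"
  by (simp add: std_gauss_def)

lemma prob_space_std_gauss: "prob_space std_gauss"
  unfolding std_gauss_def by (rule prob_space_normal_density) simp

lemma std_gauss_mean: "integrable std_gauss (\<lambda>y. y)" "(\<integral>y. y \<partial>std_gauss) = 0"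
proof -
  have "has_bochner_integral lborel (\<lambda>y. std_normal_density y * y ^ (2 * 0 + 1)) 0"
    by (rule std_normal_moment_odd)
  then show "integrable std_gauss (\<lambda>y. y)" "(\<integral>y. y \<partial>std_gauss) = 0"
    by (auto simp: std_gauss_def has_bochner_integral_iff integrable_density integral_density)
qed

lemma std_gauss_fourth_moment: "(\<integral>\<^sup>+y. ennreal (y ^ 4) \<partial>std_gauss) = 3"
proof -
  have "has_bochner_integral lborel (\<lambda>y. std_normal_density y * y ^ (2 * 2))
      (fact (2 * 2) / (2 ^ 2 * fact 2))"
    by (rule std_normal_moment_even)
  then have h: "has_bochner_integral lborel (\<lambda>y. std_normal_density y * y ^ 4) 3"
    by (simp add: fact_numeral)
  have "(\<integral>\<^sup>+y. ennreal (y ^ 4) \<partial>std_gauss)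
      = (\<integral>\<^sup>+y. ennreal (std_normal_density y * y ^ 4) \<partial>lborel)"
    by (simp add: std_gauss_def nn_integral_density ennreal_mult)
  also have "\<dots> = ennreal (\<integral>y. std_normal_density y * y ^ 4 \<partial>lborel)"
    using h by (intro nn_integral_eq_integral) (auto simp: has_bochner_integral_iff)
  also have "\<dots> = 3"
    using h by (simp add: has_bochner_integral_iff)
  finally show ?thesis .
qed

text \<open>The Cameron-Martin formula in dimension one: the exponential is the density of the law of
  \<open>s + y\<close> relative to that of \<open>y\<close>.\<close>

lemma std_gauss_shift:
  assumes [measurable]: "f \<in> borel_measurable borel"
  shows "(\<integral>\<^sup>+y. f (s + y) \<partial>std_gauss)
    = (\<integral>\<^sup>+y. ennreal (exp (s * y - s\<^sup>2 / 2)) * f y \<partial>std_gauss)"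
proof -
  have "(\<integral>\<^sup>+y. f (s + y) \<partial>std_gauss)
      = (\<integral>\<^sup>+y. ennreal (std_normal_density (s + y - s)) * f (s + y) \<partial>lborel)"
    by (simp add: std_gauss_def nn_integral_density)
  also have "\<dots> = (\<integral>\<^sup>+y. ennreal (std_normal_density (y - s)) * f y \<partial>lborel)"
    using nn_integral_real_affine[of "\<lambda>y. ennreal (std_normal_density (y - s)) * f y" 1 s]
    by simp
  also have "\<dots> = (\<integral>\<^sup>+y. ennreal (std_normal_density y)
      * (ennreal (exp (s * y - s\<^sup>2 / 2)) * f y) \<partial>lborel)"
  proof (intro nn_integral_cong)
    fix y :: real
    have "std_normal_density (y - s) = std_normal_density y * exp (s * y - s\<^sup>2 / 2)"
      by (simp add: std_normal_density_def exp_add[symmetric] power2_diff field_simps)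
    then show "ennreal (std_normal_density (y - s)) * f y
        = ennreal (std_normal_density y) * (ennreal (exp (s * y - s\<^sup>2 / 2)) * f y)"
      by (simp add: ennreal_mult mult.assoc)
  qed
  also have "\<dots> = (\<integral>\<^sup>+y. ennreal (exp (s * y - s\<^sup>2 / 2)) * f y \<partial>std_gauss)"
    by (simp add: std_gauss_def nn_integral_density)
  finally show ?thesis .
qed

lemma borel_measurable_projections:
  "fst \<in> borel_measurable (borel :: ('x::euclidean_space \<times> 'y::euclidean_space) measure)"
  "snd \<in> borel_measurable (borel :: ('x \<times> 'y) measure)"
  by (auto intro!: borel_measurable_continuous_onI continuous_intros)

text \<open>
  One family of laws serves both purposes: with \<open>f = (\<lambda>z w. s * (g w - k z))\<close> it is the law of an
  error term together with \<open>(Z, W)\<close>, and with \<open>f = (\<lambda>z w. s * g w)\<close> it is the law of the resulting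
  observation.
\<close>

definition gauss_law ::
  "'a measure \<Rightarrow> ('a \<Rightarrow> 'b::euclidean_space) \<Rightarrow> ('a \<Rightarrow> 'c::euclidean_space)
     \<Rightarrow> ('b \<Rightarrow> 'c \<Rightarrow> real) \<Rightarrow> (real \<times> 'b \<times> 'c) measure" where
  "gauss_law M Z W f =
     distr (M \<Otimes>\<^sub>M std_gauss) borel (\<lambda>(x, y). (f (Z x) (W x) + y, Z x, W x))"

lemma sets_gauss_law[simp, measurable_cong]: "sets (gauss_law M Z W f) = sets borel"
  by (simp add: gauss_law_def)

lemma space_gauss_law[simp]: "space (gauss_law M Z W f) = UNIV"
  by (simp add: gauss_law_def)

locale random_pair = prob_space M for M :: "'a measure" +
  fixes Z :: "'a \<Rightarrow> 'b::euclidean_space" and W :: "'a \<Rightarrow> 'c::euclidean_space"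
  assumes Z_meas[measurable]: "Z \<in> borel_measurable M"
    and W_meas[measurable]: "W \<in> borel_measurable M"
begin

lemma ZW_meas: "(\<lambda>x. (Z x, W x)) \<in> borel_measurable M"
  by (intro borel_measurable_Pair) measurable

lemma shift_meas:
  assumes "case_prod f \<in> borel_measurable borel"
  shows "(\<lambda>x. f (Z x) (W x)) \<in> borel_measurable M"
  using measurable_compose[OF ZW_meas assms] by simp

lemma gauss_map_meas:
  assumes f: "case_prod f \<in> borel_measurable borel"
  shows "(\<lambda>(x, y). (f (Z x) (W x) + y, Z x, W x)) \<in> borel_measurable (M \<Otimes>\<^sub>M std_gauss)"
proof -
  note [measurable] = shift_meas[OF f]
  show ?thesis
    unfolding split_beta' by (intro borel_measurable_Pair) measurable
qed

sublocale pair: pair_prob_space M std_gauss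
  by (intro pair_prob_space.intro pair_sigma_finite.intro prob_space_imp_sigma_finite
      prob_space_std_gauss prob_space_axioms)

lemma prob_space_gauss_law:
  assumes "case_prod f \<in> borel_measurable borel"
  shows "prob_space (gauss_law M Z W f)"
  unfolding gauss_law_def using gauss_map_meas[OF assms] by (rule pair.prob_space_distr)

lemma nn_integral_gauss_law:
  assumes f: "case_prod f \<in> borel_measurable borel" and G[measurable]: "G \<in> borel_measurable borel"
  shows "(\<integral>\<^sup>+t. G t \<partial>gauss_law M Z W f)
    = (\<integral>\<^sup>+x. \<integral>\<^sup>+y. G (f (Z x) (W x) + y, Z x, W x) \<partial>std_gauss \<partial>M)"
proof -
  note [measurable] = gauss_map_meas[OF f]
  have "(\<integral>\<^sup>+t. G t \<partial>gauss_law M Z W f)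
      = (\<integral>\<^sup>+p. G (case p of (x, y) \<Rightarrow> (f (Z x) (W x) + y, Z x, W x)) \<partial>(M \<Otimes>\<^sub>M std_gauss))"
    unfolding gauss_law_def by (intro nn_integral_distr) measurable
  also have "\<dots> = (\<integral>\<^sup>+x. \<integral>\<^sup>+y. G (case (x, y) of (x, y) \<Rightarrow> (f (Z x) (W x) + y, Z x, W x))
      \<partial>std_gauss \<partial>M)"
    by (intro pair.M2.nn_integral_fst[symmetric]) measurable
  finally show ?thesis by simp
qed

lemma obs_law_gauss_law:
  assumes f: "case_prod f \<in> borel_measurable borel" and \<phi>[measurable]: "\<phi> \<in> borel_measurable borel"
  shows "obs_law (gauss_law M Z W f) \<phi> = gauss_law M Z W (\<lambda>z w. \<phi> z + f z w)"
proof -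
  have m: "(\<lambda>t. (\<phi> (fst (snd t)) + fst t, snd t)) \<in> borel_measurable
      (borel :: (real \<times> 'b \<times> 'c) measure)"
    by (intro borel_measurable_Pair borel_measurable_add
        measurable_compose[OF _ \<phi>] borel_measurable_continuous_onI continuous_intros)
  show ?thesis
    unfolding obs_law_def gauss_law_def
    using gauss_map_meas[OF f] m
    by (subst distr_distr) (auto simp: comp_def split_beta' add.assoc intro!: distr_cong)
qed

lemma gauss_law_density:
  assumes f: "case_prod f \<in> borel_measurable borel"
  shows "gauss_law M Z W f
    = density (gauss_law M Z W (\<lambda>_ _. 0))
        (\<lambda>(y, z, w). ennreal (exp (f z w * y - (f z w)\<^sup>2 / 2)))" (is "_ = density ?P ?L")
proof (rule measure_eqI)
  note [measurable] = borel_measurable_projections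
    measurable_compose[OF borel_measurable_projections(2) f] shift_meas[OF f]
  have L[measurable]: "?L \<in> borel_measurable borel"
  proof -
    have "?L = (\<lambda>t. ennreal (exp (case_prod f (snd t) * fst t - (case_prod f (snd t))\<^sup>2 / 2)))"
      by (auto simp: fun_eq_iff)
    also have "\<dots> \<in> borel_measurable borel"
      by measurable
    finally show ?thesis .
  qed
  show "sets (gauss_law M Z W f) = sets (density ?P ?L)"
    by simp
  fix A assume "A \<in> sets (gauss_law M Z W f)"
  then have [measurable]: "A \<in> sets borel" by simp
  have sec[measurable]: "(\<lambda>y::real. (y, q)) \<in> borel_measurable borel" for q :: "'b \<times> 'c"
    by (intro borel_measurable_Pair) auto
  have "emeasure (gauss_law M Z W f) A = (\<integral>\<^sup>+t. indicator A t \<partial>gauss_law M Z W f)"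
    by simp
  also have "\<dots> = (\<integral>\<^sup>+x. \<integral>\<^sup>+y. indicator A (f (Z x) (W x) + y, Z x, W x) \<partial>std_gauss \<partial>M)"
    by (intro nn_integral_gauss_law f) measurable
  also have "\<dots> = (\<integral>\<^sup>+x. \<integral>\<^sup>+y. ennreal (exp (f (Z x) (W x) * y - (f (Z x) (W x))\<^sup>2 / 2))
      * indicator A (y, Z x, W x) \<partial>std_gauss \<partial>M)"
    by (intro nn_integral_cong std_gauss_shift) measurable
  also have "\<dots> = (\<integral>\<^sup>+x. \<integral>\<^sup>+y. (\<lambda>t. ?L t * indicator A t) (0 + y, Z x, W x) \<partial>std_gauss \<partial>M)"
    by simp
  also have "\<dots> = (\<integral>\<^sup>+t. ?L t * indicator A t \<partial>?P)"
    by (intro nn_integral_gauss_law[symmetric]) auto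
  also have "\<dots> = emeasure (density ?P ?L) A"
    by (intro emeasure_density[symmetric]) auto
  finally show "emeasure (gauss_law M Z W f) A = emeasure (density ?P ?L) A" .
qed

lemma distr_gauss_law:
  assumes f: "case_prod f \<in> borel_measurable borel"
  shows "distr (gauss_law M Z W f) borel (\<lambda>(u, z, w). (z, w)) = distr M borel (\<lambda>x. (Z x, W x))"
proof -
  have "distr (gauss_law M Z W f) borel (\<lambda>(u, z, w). (z, w))
      = distr (M \<Otimes>\<^sub>M std_gauss) borel ((\<lambda>x. (Z x, W x)) \<circ> fst)"
    unfolding gauss_law_def using gauss_map_meas[OF f] borel_measurable_projections(2)
    by (subst distr_distr) (auto simp: comp_def split_beta' intro!: distr_cong)
  also have "\<dots> = distr (distr (M \<Otimes>\<^sub>M std_gauss) M fst) borel (\<lambda>x. (Z x, W x))"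
    by (intro distr_distr[symmetric] ZW_meas) measurable
  finally show ?thesis
    by (simp add: pair.M2.distr_pair_fst)
qed

text \<open>
  The error is \<open>a * (g W - k Z) + \<epsilon>\<close> with an independent standard Gaussian \<open>\<epsilon>\<close>. On events of the
  form \<open>W -` B\<close> its mean vanishes, because \<open>g W\<close> and \<open>k Z\<close> have equal integrals there, and its fourth
  moment is at most \<open>27\<close> times the sum of the fourth moments of the three summands, whose conditional
  versions given \<open>W\<close> are bounded by \<open>\<eta>\<close>, \<open>\<eta>\<close> and \<open>3\<close>.
\<close>

lemma gauss_law_error_law:
  fixes k :: "'b \<Rightarrow> real" and g :: "'c \<Rightarrow> real"
  assumes k[measurable]: "k \<in> borel_measurable borel" and g[measurable]: "g \<in> borel_measurable borel"
    and kZ: "integrable M (\<lambda>x. k (Z x))" and gW: "integrable M (\<lambda>x. g (W x))"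
    and cond: "AE x in M. g (W x) = real_cond_exp M (sigma_gen M W) (\<lambda>x. k (Z x)) x"
    and fourth: "AE x in M. nn_cond_exp M (sigma_gen M W) (\<lambda>x. ennreal (k (Z x) ^ 4)) x \<le> ennreal \<eta>"
    and "0 \<le> \<eta>" and a: "a ^ 4 \<le> 1" and \<sigma>: "27 * (2 * \<eta> + 3) \<le> \<sigma> ^ 4"
  shows "gauss_law M Z W (\<lambda>z w. a * (g w - k z)) \<in> error_laws M Z W \<sigma>"
proof -
  let ?s = "\<lambda>z w. a * (g w - k z)"
  let ?Q = "gauss_law M Z W ?s"
  let ?w = "\<lambda>(u::real, z::'b, w::'c). w" and ?u = "\<lambda>(u::real, z::'b, w::'c). u"
  have s: "case_prod ?s \<in> borel_measurable borel"
  proof -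
    note [measurable] = measurable_compose[OF borel_measurable_projections(1) k]
      measurable_compose[OF borel_measurable_projections(2) g]
    show ?thesis
      unfolding split_beta' by measurable
  qed
  have w[measurable]: "?w \<in> borel_measurable borel" and u[measurable]: "?u \<in> borel_measurable borel"
    unfolding split_beta'
    by (auto intro!: borel_measurable_continuous_onI continuous_intros)
  interpret Q: prob_space ?Q
    by (rule prob_space_gauss_law[OF s])
  interpret QF: finite_measure_subalgebra ?Q "sigma_gen ?Q ?w"
    by (intro finite_measure_subalgebra_sigma_gen Q.finite_measure_axioms) simp
  interpret MF: finite_measure_subalgebra M "sigma_gen M W"
    by (intro finite_measure_subalgebra_sigma_gen finite_measure_axioms) simp
  have int_s: "integrable M (\<lambda>x. ?s (Z x) (W x))"
    using kZ gW by auto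
  have int_sp: "integrable (M \<Otimes>\<^sub>M std_gauss) (\<lambda>p. ?s (Z (fst p)) (W (fst p)))"
    using int_s by (subst (asm) pair.M2.distr_pair_fst[of M, symmetric],
      subst (asm) integrable_distr_eq) auto
  have int_y: "integrable (M \<Otimes>\<^sub>M std_gauss) (\<lambda>p. snd p)"
    by (rule pair.Fubini_integrable) (auto simp: std_gauss_mean)
  have int_u: "integrable (M \<Otimes>\<^sub>M std_gauss) (\<lambda>p. ?s (Z (fst p)) (W (fst p)) + snd p)"
    by (intro Bochner_Integration.integrable_add int_sp int_y)
  have int_Q: "integrable ?Q ?u"
    unfolding gauss_law_def using gauss_map_meas[OF s] int_u u
    by (subst integrable_distr_eq) (simp_all add: split_beta')
  have mean: "AE t in ?Q. real_cond_exp ?Q (sigma_gen ?Q ?w) ?u t = 0"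
  proof (rule QF.real_cond_exp_charact)
    fix A assume "A \<in> sets (sigma_gen ?Q ?w)"
    then obtain B where A: "A = ?w -` B" and [measurable]: "B \<in> sets borel"
      by (auto simp: sets_sigma_gen)
    let ?A = "W -` B \<inter> space M"
    have A'[measurable]: "?A \<in> sets (sigma_gen M W)" "?A \<in> sets M"
      by (auto simp: sets_sigma_gen)
    have "(LINT t:A|?Q. ?u t) = (\<integral>t. indicator B (?w t) * ?u t \<partial>?Q)"
      by (auto simp: set_lebesgue_integral_def A indicator_def intro!: Bochner_Integration.integral_cong)
    also have "\<dots> = (\<integral>p. indicator B (W (fst p)) * (?s (Z (fst p)) (W (fst p)) + snd p)
        \<partial>(M \<Otimes>\<^sub>M std_gauss))"
    proof -
      have "(\<lambda>t. indicator B (?w t) * ?u t) \<in> borel_measurable borel"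
        by measurable
      then show ?thesis
        unfolding gauss_law_def using gauss_map_meas[OF s]
        by (subst integral_distr) (simp_all add: split_beta')
    qed
    also have "\<dots> = (\<integral>x. \<integral>y. indicator B (W x) * (?s (Z x) (W x) + y) \<partial>std_gauss \<partial>M)"
    proof -
      have "integrable (M \<Otimes>\<^sub>M std_gauss)
          (\<lambda>p. indicator B (W (fst p)) * (?s (Z (fst p)) (W (fst p)) + snd p))"
        by (rule Bochner_Integration.integrable_bound[OF int_u]) (auto simp: indicator_def)
      from pair.integral_fst'[OF this] show ?thesis by simp
    qed
    also have "\<dots> = (\<integral>x. indicator B (W x) * ?s (Z x) (W x) \<partial>M)"
      using std_gauss_mean pair.M2.prob_space
      by (simp add: Bochner_Integration.integral_add)
    also have "\<dots> = (\<integral>x. a * (indicator ?A x * g (W x) - indicator ?A x * k (Z x)) \<partial>M)"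
      by (intro Bochner_Integration.integral_cong) (auto simp: indicator_def)
    also have "\<dots> = a * ((\<integral>x. indicator ?A x * g (W x) \<partial>M) - (\<integral>x. indicator ?A x * k (Z x) \<partial>M))"
      using integrable_real_mult_indicator[OF A'(2) gW] integrable_real_mult_indicator[OF A'(2) kZ]
      by (simp add: mult.commute)
    also have "(\<integral>x. indicator ?A x * k (Z x) \<partial>M) = (\<integral>x. indicator ?A x * g (W x) \<partial>M)"
    proof -
      have "(\<integral>x. indicator ?A x * k (Z x) \<partial>M)
          = (\<integral>x. indicator ?A x * real_cond_exp M (sigma_gen M W) (\<lambda>x. k (Z x)) x \<partial>M)"
        using MF.real_cond_exp_intA[OF kZ A'(1)] by (simp add: set_lebesgue_integral_def)
      also have "\<dots> = (\<integral>x. indicator ?A x * g (W x) \<partial>M)"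
        using cond by (intro integral_cong_AE) auto
      finally show ?thesis .
    qed
    also have "a * ((\<integral>x. indicator ?A x * g (W x) \<partial>M) - (\<integral>x. indicator ?A x * g (W x) \<partial>M)) = 0"
      by simp
    also have "0 = (LINT t:A|?Q. 0)"
      by (simp add: set_lebesgue_integral_def)
    finally show "(LINT t:A|?Q. ?u t) = (LINT t:A|?Q. 0)" .
  qed (use int_Q in auto)
  have g4: "AE x in M. g (W x) ^ 4 \<le> \<eta>"
    using MF.cond_exp_power4_le[OF kZ fourth \<open>0 \<le> \<eta>\<close>] cond by eventually_elim simp
  have "AE t in ?Q. nn_cond_exp ?Q (sigma_gen ?Q ?w) (\<lambda>t. ennreal (?u t ^ 4)) t \<le> ennreal (\<sigma> ^ 4)"
  proof (rule QF.nn_cond_exp_le_const)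
    fix A assume "A \<in> sets (sigma_gen ?Q ?w)"
    then obtain B where A: "A = ?w -` B" and [measurable]: "B \<in> sets borel"
      by (auto simp: sets_sigma_gen)
    let ?A = "W -` B \<inter> space M"
    have A'[measurable]: "?A \<in> sets (sigma_gen M W)" "?A \<in> sets M"
      by (auto simp: sets_sigma_gen)
    have Am: "A \<in> sets borel"
      using measurable_sets[OF w \<open>B \<in> sets borel\<close>] by (simp add: A)
    have "emeasure ?Q A = (\<integral>\<^sup>+t. indicator A t \<partial>?Q)"
      using Am by simp
    also have "\<dots> = (\<integral>\<^sup>+x. \<integral>\<^sup>+y. indicator A (?s (Z x) (W x) + y, Z x, W x) \<partial>std_gauss \<partial>M)"
      using Am by (intro nn_integral_gauss_law s) simp
    also have "\<dots> = (\<integral>\<^sup>+x. indicator ?A x \<partial>M)"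
      using pair.M2.emeasure_space_1
      by (intro nn_integral_cong) (auto simp: A indicator_def)
    also have "\<dots> = emeasure M ?A"
      by simp
    finally have QA: "emeasure ?Q A = emeasure M ?A" .
    have kint: "(\<integral>\<^sup>+x\<in>?A. ennreal (k (Z x) ^ 4) \<partial>M) \<le> ennreal \<eta> * emeasure M ?A"
    proof -
      have "(\<integral>\<^sup>+x. indicator ?A x * ennreal (k (Z x) ^ 4) \<partial>M)
        = (\<integral>\<^sup>+x. indicator ?A x * nn_cond_exp M (sigma_gen M W) (\<lambda>x. ennreal (k (Z x) ^ 4)) x \<partial>M)"
        by (intro MF.nn_cond_exp_intg[symmetric]) measurable
      also have "\<dots> \<le> (\<integral>\<^sup>+x. ennreal \<eta> * indicator ?A x \<partial>M)"
        using fourth by (intro nn_integral_mono_AE) (auto simp: indicator_def)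
      also have "\<dots> = ennreal \<eta> * emeasure M ?A"
        by (simp add: nn_integral_cmult_indicator)
      finally show ?thesis by (simp add: mult.commute)
    qed
    have "(\<integral>\<^sup>+t\<in>A. ennreal (?u t ^ 4) \<partial>?Q)
        = (\<integral>\<^sup>+x. \<integral>\<^sup>+y. ennreal ((?s (Z x) (W x) + y) ^ 4) * indicator A (?s (Z x) (W x) + y, Z x, W x)
            \<partial>std_gauss \<partial>M)"
    proof -
      note [measurable] = Am
      have "(\<lambda>t. ennreal (?u t ^ 4) * indicator A t) \<in> borel_measurable borel"
        by measurable
      from nn_integral_gauss_law[OF s this] show ?thesis by simp
    qed
    also have "\<dots> \<le> (\<integral>\<^sup>+x. ennreal (27 * (\<eta> + 3)) * indicator ?A x
        + 27 * (ennreal (k (Z x) ^ 4) * indicator ?A x) \<partial>M)"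
    proof (intro nn_integral_mono_AE)
      show "AE x in M. (\<integral>\<^sup>+y. ennreal ((?s (Z x) (W x) + y) ^ 4)
            * indicator A (?s (Z x) (W x) + y, Z x, W x) \<partial>std_gauss)
          \<le> ennreal (27 * (\<eta> + 3)) * indicator ?A x + 27 * (ennreal (k (Z x) ^ 4) * indicator ?A x)"
        using g4 AE_space
      proof eventually_elim
        case (elim x)
        have pt: "(?s (Z x) (W x) + y) ^ 4 \<le> 27 * (\<eta> + k (Z x) ^ 4) + 27 * y ^ 4" for y
        proof -
          have "(?s (Z x) (W x) + y) ^ 4 = (a * g (W x) + (- (a * k (Z x))) + y) ^ 4"
            by (simp add: algebra_simps)
          also have "\<dots> \<le> 27 * ((a * g (W x)) ^ 4 + (- (a * k (Z x))) ^ 4 + y ^ 4)"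
            by (rule power4_sum3_le)
          also have "\<dots> = 27 * (a ^ 4 * g (W x) ^ 4 + a ^ 4 * k (Z x) ^ 4 + y ^ 4)"
            by (simp add: power_mult_distrib)
          also have "\<dots> \<le> 27 * (1 * \<eta> + 1 * k (Z x) ^ 4 + y ^ 4)"
            using elim(1) a by (intro mult_left_mono add_mono mult_mono) auto
          finally show ?thesis by simp
        qed
        have "(\<integral>\<^sup>+y. ennreal ((?s (Z x) (W x) + y) ^ 4) \<partial>std_gauss)
          \<le> (\<integral>\<^sup>+y. ennreal (27 * (\<eta> + k (Z x) ^ 4)) + 27 * ennreal (y ^ 4) \<partial>std_gauss)"
        proof (intro nn_integral_mono)
          fix y
          have "ennreal (27 * (\<eta> + k (Z x) ^ 4)) + 27 * ennreal (y ^ 4)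
              = ennreal (27 * (\<eta> + k (Z x) ^ 4) + 27 * y ^ 4)"
            using \<open>0 \<le> \<eta>\<close> by (simp add: ennreal_mult)
          then show "ennreal ((?s (Z x) (W x) + y) ^ 4)
              \<le> ennreal (27 * (\<eta> + k (Z x) ^ 4)) + 27 * ennreal (y ^ 4)"
            using pt by (simp only:) (rule ennreal_leI)
        qed
        also have "\<dots> = ennreal (27 * (\<eta> + k (Z x) ^ 4)) + 27 * 3"
          using pair.M2.emeasure_space_1
          by (simp add: nn_integral_add nn_integral_cmult std_gauss_fourth_moment)
        also have "27 * 3 = ennreal 81"
          by simp
        also have "ennreal (27 * (\<eta> + k (Z x) ^ 4)) + ennreal 81
            = ennreal (27 * (\<eta> + 3)) + 27 * ennreal (k (Z x) ^ 4)"
        proof -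
          have "ennreal (27 * (\<eta> + k (Z x) ^ 4)) + ennreal 81
              = ennreal (27 * (\<eta> + k (Z x) ^ 4) + 81)"
            using \<open>0 \<le> \<eta>\<close> by (intro ennreal_plus[symmetric]) auto
          also have "27 * (\<eta> + k (Z x) ^ 4) + 81 = 27 * (\<eta> + 3) + 27 * k (Z x) ^ 4"
            by simp
          also have "ennreal \<dots> = ennreal (27 * (\<eta> + 3)) + ennreal (27 * k (Z x) ^ 4)"
            using \<open>0 \<le> \<eta>\<close> by (intro ennreal_plus) auto
          finally show ?thesis
            by (simp add: ennreal_mult)
        qed
        finally show ?case
          using elim(2) by (cases "W x \<in> B") (simp_all add: A)
      qed
    qed
    also have "\<dots> = ennreal (27 * (\<eta> + 3)) * emeasure M ?A
        + 27 * (\<integral>\<^sup>+x\<in>?A. ennreal (k (Z x) ^ 4) \<partial>M)"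
      by (simp add: nn_integral_add nn_integral_cmult nn_integral_cmult_indicator)
    also have "\<dots> \<le> ennreal (27 * (\<eta> + 3)) * emeasure M ?A + 27 * (ennreal \<eta> * emeasure M ?A)"
      by (intro add_left_mono mult_left_mono kint) simp
    also have "\<dots> = ennreal (27 * (2 * \<eta> + 3)) * emeasure M ?A"
    proof -
      have "27 * (2 * \<eta> + 3) = 27 * (\<eta> + 3) + 27 * \<eta>"
        by simp
      then have "ennreal (27 * (2 * \<eta> + 3)) = ennreal (27 * (\<eta> + 3)) + 27 * ennreal \<eta>"
        using \<open>0 \<le> \<eta>\<close> by (simp only:) (subst ennreal_plus, auto simp: ennreal_mult)
      then show ?thesis
        by (simp add: distrib_right mult.assoc)
    qed
    also have "\<dots> \<le> ennreal (\<sigma> ^ 4) * emeasure ?Q A"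
      unfolding QA by (intro mult_right_mono ennreal_leI \<sigma>) simp
    finally show "(\<integral>\<^sup>+t\<in>A. ennreal (?u t ^ 4) \<partial>?Q) \<le> ennreal (\<sigma> ^ 4) * emeasure ?Q A" .
  qed auto
  with mean int_Q show ?thesis
    unfolding error_laws_def error_term_def
    using Q.prob_space_axioms distr_gauss_law[OF s] by (simp add: split_beta')
qed

end

section \<open>The two-point bound\<close>

text \<open>
  Here \<open>A\<close> and \<open>B\<close> play the role of two densities, \<open>r\<close> that of their geometric mean, and \<open>t\<close> that of
  the estimate of \<open>c\<close> respectively \<open>-c\<close>. By the triangle inequality the two errors add up to at least
  \<open>2 * \<bar>c\<bar>\<close>; the inequality between the arithmetic and the geometric mean turns this into a bound for
  the squared errors. Being linear in \<open>A\<close>, \<open>B\<close> and \<open>r\<close> it can be integrated as it stands, and the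
  factor \<open>1/4\<close> is chosen for an affinity of at least \<open>3/4\<close>, where
  \<open>2 * (3/4) - (1/4) * 2 = 1\<close> leaves exactly \<open>c\<^sup>2\<close>.
\<close>

lemma affinity_pointwise:
  fixes t c A B r :: real
  assumes "0 \<le> A" "0 \<le> B" "r\<^sup>2 = A * B" "0 \<le> r"
  shows "2 * c\<^sup>2 * r \<le> A * (t - c)\<^sup>2 + B * (t + c)\<^sup>2 + c\<^sup>2 / 4 * (A + B)"
proof -
  have r: "r = sqrt A * sqrt B"
    using assms by (metis real_sqrt_mult real_sqrt_unique)
  have amgm: "\<bar>c\<bar> * r * \<bar>v\<bar> \<le> P * v\<^sup>2 + c\<^sup>2 / 4 * R"
    if "0 \<le> P" "0 \<le> R" "r = sqrt P * sqrt R" for v P R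
  proof -
    have "2 * (sqrt P * \<bar>v\<bar>) * (\<bar>c\<bar> / 2 * sqrt R) \<le> (sqrt P * \<bar>v\<bar>)\<^sup>2 + (\<bar>c\<bar> / 2 * sqrt R)\<^sup>2"
      by (rule sum_squares_bound)
    then show ?thesis
      using that by (simp add: power_mult_distrib power_divide mult_ac)
  qed
  have "2 * c\<^sup>2 * r = \<bar>c\<bar> * r * (2 * \<bar>c\<bar>)"
    by (simp add: power2_eq_square mult_ac)
  also have "\<dots> \<le> \<bar>c\<bar> * r * (\<bar>t - c\<bar> + \<bar>t + c\<bar>)"
    using \<open>0 \<le> r\<close> by (intro mult_left_mono) auto
  also have "\<dots> \<le> (A * (t - c)\<^sup>2 + c\<^sup>2 / 4 * B) + (B * (t + c)\<^sup>2 + c\<^sup>2 / 4 * A)"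
    unfolding distrib_left using assms r
    by (intro add_mono amgm) (auto simp: mult.commute)
  finally show ?thesis
    by (simp add: field_simps)
qed

text \<open>
  The \<open>n\<close>-fold products inherit densities and geometric mean as products over the sample. The affinity is
  therefore multiplicative, at least \<open>(1 - x) ^ n \<ge> 1 - n * x \<ge> 3/4\<close>, and integrating
  \<open>affinity_pointwise\<close> bounds the sum of the two risks.
\<close>

lemma two_point_risk:
  fixes P :: "(real \<times> 'b::euclidean_space \<times> 'c::euclidean_space) measure"
    and A B r :: "real \<times> 'b \<times> 'c \<Rightarrow> real"
  assumes P: "prob_space P" "sets P = sets borel"
    and [measurable]: "A \<in> borel_measurable borel" "B \<in> borel_measurable borel"
      "r \<in> borel_measurable borel"
    and nonneg: "\<And>t. 0 \<le> A t" "\<And>t. 0 \<le> B t" "\<And>t. 0 \<le> r t"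
    and AB: "\<And>t. (r t)\<^sup>2 = A t * B t"
    and PA: "prob_space (density P A)" and PB: "prob_space (density P B)"
    and r: "ennreal (1 - x) \<le> (\<integral>\<^sup>+t. r t \<partial>P)" and x: "0 \<le> x" "real n * x \<le> 1 / 4" "n \<ge> 1"
    and est: "est \<in> estimators n"
  shows "ennreal (c\<^sup>2) \<le> risk n (density P A) est c + risk n (density P B) est (- c)"
proof -
  let ?I = "{1..n}"
  let ?PI = "\<Pi>\<^sub>M i\<in>?I. P"
  have A'[measurable]: "A \<in> borel_measurable P" "B \<in> borel_measurable P" "r \<in> borel_measurable P"
    using P(2) by (simp_all cong: measurable_cong_sets)
  have est'[measurable]: "est \<in> borel_measurable ?PI"
    using est P(2) unfolding estimators_def
    by (simp cong: measurable_cong_sets sets_PiM_cong)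
  interpret P: product_sigma_finite "\<lambda>_. P"
    using P by (simp add: product_sigma_finite_def prob_space_imp_sigma_finite)
  let ?A = "\<lambda>s. \<Prod>i\<in>?I. A (s i)" and ?B = "\<lambda>s. \<Prod>i\<in>?I. B (s i)" and ?r = "\<lambda>s. \<Prod>i\<in>?I. r (s i)"
  have risk_eq: "risk n (density P D) est l
      = (\<integral>\<^sup>+s. ennreal ((\<Prod>i\<in>?I. D (s i)) * (est s - l)\<^sup>2) \<partial>?PI)"
    if [measurable]: "D \<in> borel_measurable P" and "\<And>t. 0 \<le> D t" "prob_space (density P D)" for D l
  proof -
    have "(\<Pi>\<^sub>M i\<in>?I. density P D) = density ?PI (\<lambda>s. \<Prod>i\<in>?I. ennreal (D (s i)))"
      using that P by (intro PiM_density) auto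
    also have "\<dots> = density ?PI (\<lambda>s. ennreal (\<Prod>i\<in>?I. D (s i)))"
      using that by (simp add: prod_ennreal)
    finally have dens: "(\<Pi>\<^sub>M i\<in>?I. density P D) = density ?PI (\<lambda>s. ennreal (\<Prod>i\<in>?I. D (s i)))" .
    have "risk n (density P D) est l
        = (\<integral>\<^sup>+s. ennreal (\<Prod>i\<in>?I. D (s i)) * ennreal ((est s - l)\<^sup>2) \<partial>?PI)"
      unfolding risk_def dens power2_abs by (intro nn_integral_density) measurable
    then show ?thesis
      using that(2) by (simp add: ennreal_mult prod_nonneg)
  qed
  have total: "(\<integral>\<^sup>+s. ennreal (\<Prod>i\<in>?I. D (s i)) \<partial>?PI) = 1"
    if [measurable]: "D \<in> borel_measurable P" and "\<And>t. 0 \<le> D t" and D: "prob_space (density P D)" for D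
  proof -
    have "(\<integral>\<^sup>+s. ennreal (\<Prod>i\<in>?I. D (s i)) \<partial>?PI) = (\<Prod>i\<in>?I. \<integral>\<^sup>+t. D t \<partial>P)"
      using that by (subst P.product_nn_integral_prod[symmetric]) (auto simp: prod_ennreal)
    also have "(\<integral>\<^sup>+t. D t \<partial>P) = 1"
      using prob_space.emeasure_space_1[OF D] by (simp add: emeasure_density cong: nn_integral_cong)
    finally show ?thesis by simp
  qed
  have "ennreal (3 / 4) \<le> ennreal ((1 - x) ^ n)"
  proof (rule ennreal_leI)
    have "x \<le> real n * x"
      using x by (simp add: mult_le_cancel_right1)
    then have "1 + real n * (- x) \<le> (1 + - x) ^ n"
      using x by (intro Bernoulli_inequality) auto
    then show "3 / 4 \<le> (1 - x) ^ n"
      using x by simp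
  qed
  also have "\<dots> = ennreal (1 - x) ^ n"
  proof -
    have "x \<le> real n * x"
      using x by (simp add: mult_le_cancel_right1)
    then show ?thesis
      using x by (simp add: ennreal_power)
  qed
  also have "\<dots> \<le> (\<integral>\<^sup>+t. r t \<partial>P) ^ n"
    by (intro power_mono r) simp
  also have "\<dots> = (\<integral>\<^sup>+s. ennreal (?r s) \<partial>?PI)"
    using nonneg P.product_nn_integral_prod[of ?I "\<lambda>_ t. ennreal (r t)"] by (simp add: prod_ennreal)
  finally have aff: "ennreal (3 / 4) \<le> (\<integral>\<^sup>+s. ennreal (?r s) \<partial>?PI)" .
  let ?R = "risk n (density P A) est c + risk n (density P B) est (- c)"
  have "ennreal (c\<^sup>2) + ennreal (c\<^sup>2 / 2) = ennreal (2 * c\<^sup>2) * ennreal (3 / 4)"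
    by (simp add: ennreal_mult[symmetric] ennreal_plus[symmetric] del: ennreal_plus)
  also have "\<dots> \<le> ennreal (2 * c\<^sup>2) * (\<integral>\<^sup>+s. ennreal (?r s) \<partial>?PI)"
    by (intro mult_left_mono aff) simp
  also have "\<dots> = (\<integral>\<^sup>+s. ennreal (2 * c\<^sup>2 * ?r s) \<partial>?PI)"
    using nonneg by (simp add: nn_integral_cmult ennreal_mult prod_nonneg)
  also have "\<dots> \<le> (\<integral>\<^sup>+s. ennreal (?A s * (est s - c)\<^sup>2 + ?B s * (est s + c)\<^sup>2
      + c\<^sup>2 / 4 * (?A s + ?B s)) \<partial>?PI)"
  proof (intro nn_integral_mono ennreal_leI affinity_pointwise)
    fix s :: "nat \<Rightarrow> real \<times> 'b \<times> 'c"
    show "(?r s)\<^sup>2 = ?A s * ?B s"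
      by (simp add: prod_power_distrib AB prod.distrib)
  qed (auto intro!: prod_nonneg nonneg)
  also have "\<dots> = (\<integral>\<^sup>+s. (ennreal (?A s * (est s - c)\<^sup>2) + ennreal (?B s * (est s - (- c))\<^sup>2))
      + (ennreal (c\<^sup>2 / 4) * ennreal (?A s) + ennreal (c\<^sup>2 / 4) * ennreal (?B s)) \<partial>?PI)"
  proof (intro nn_integral_cong)
    fix s :: "nat \<Rightarrow> real \<times> 'b \<times> 'c"
    have "0 \<le> ?A s" "0 \<le> ?B s"
      by (auto intro!: prod_nonneg nonneg)
    then show "ennreal (?A s * (est s - c)\<^sup>2 + ?B s * (est s + c)\<^sup>2 + c\<^sup>2 / 4 * (?A s + ?B s))
        = (ennreal (?A s * (est s - c)\<^sup>2) + ennreal (?B s * (est s - (- c))\<^sup>2))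
          + (ennreal (c\<^sup>2 / 4) * ennreal (?A s) + ennreal (c\<^sup>2 / 4) * ennreal (?B s))"
      by (simp add: ennreal_mult[symmetric] ennreal_plus[symmetric] distrib_left del: ennreal_plus)
  qed
  also have "\<dots> = ?R + (ennreal (c\<^sup>2 / 4) * 1 + ennreal (c\<^sup>2 / 4) * 1)"
    using nonneg PA PB
    by (simp add: nn_integral_add nn_integral_cmult total risk_eq del: One_nat_def)
  also have "ennreal (c\<^sup>2 / 4) * 1 + ennreal (c\<^sup>2 / 4) * 1 = ennreal (c\<^sup>2 / 2)"
    by (simp add: ennreal_plus[symmetric] del: ennreal_plus)
  finally show ?thesis
    by (metis add.commute ennreal_add_left_cancel_le ennreal_neq_top infinity_ennreal_def)
qed

context random_pair
begin

text \<open>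
  The densities of the laws with drifts \<open>f\<close> and \<open>- f\<close> are \<open>exp (\<plusminus> f * y - f\<^sup>2 / 2)\<close>, with geometric mean
  \<open>exp (- f\<^sup>2 / 2) \<ge> 1 - f\<^sup>2 / 2\<close>; so the affinity of a single observation falls short of \<open>1\<close> by at most
  half the second moment of \<open>f (Z, W)\<close>.
\<close>

lemma gauss_law_two_point_risk:
  assumes f: "case_prod f \<in> borel_measurable borel"
    and int: "integrable M (\<lambda>x. (f (Z x) (W x))\<^sup>2)"
    and D: "real n * (\<integral>x. (f (Z x) (W x))\<^sup>2 \<partial>M) \<le> 1 / 2" and "n \<ge> 1"
    and est: "est \<in> estimators n"
  shows "ennreal (c\<^sup>2) \<le> risk n (gauss_law M Z W f) est c
    + risk n (gauss_law M Z W (\<lambda>z w. - f z w)) est (- c)"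
proof -
  let ?P = "gauss_law M Z W (\<lambda>_ _. 0)"
  let ?L = "\<lambda>s (y, z, w). exp (s * f z w * y - (f z w)\<^sup>2 / 2)"
  let ?r = "\<lambda>(y::real, z, w). exp (- ((f z w)\<^sup>2 / 2))"
  let ?D = "\<integral>x. (f (Z x) (W x))\<^sup>2 \<partial>M"
  note [measurable] = borel_measurable_projections
    measurable_compose[OF borel_measurable_projections(2) f] shift_meas[OF f]
  have "?L s = (\<lambda>t. exp (s * case_prod f (snd t) * fst t - (case_prod f (snd t))\<^sup>2 / 2))" for s
    by (auto simp: fun_eq_iff)
  then have L: "?L s \<in> borel_measurable borel" for s
    by simp
  have "?r = (\<lambda>t. exp (- ((case_prod f (snd t))\<^sup>2 / 2)))"
    by (auto simp: fun_eq_iff)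
  then have r: "?r \<in> borel_measurable borel"
    by simp
  have f': "case_prod (\<lambda>z w. - f z w) \<in> borel_measurable borel"
    using borel_measurable_uminus[OF f] by (simp add: split_beta')
  have plus: "gauss_law M Z W f = density ?P (?L 1)"
    using gauss_law_density[OF f] by (simp add: split_beta')
  have minus: "gauss_law M Z W (\<lambda>z w. - f z w) = density ?P (?L (- 1))"
    using gauss_law_density[OF f'] by (simp add: split_beta')
  show ?thesis
    unfolding plus minus
  proof (rule two_point_risk[where A = "?L 1" and B = "?L (- 1)" and r = ?r and x = "?D / 2"])
    show "prob_space ?P"
      by (rule prob_space_gauss_law) simp
    show "prob_space (density ?P (?L 1))" "prob_space (density ?P (?L (- 1)))"
      using prob_space_gauss_law[OF f] prob_space_gauss_law[OF f'] plus minus by simp_all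
    show "(?r t)\<^sup>2 = ?L 1 t * ?L (- 1) t" for t
      by (cases t) (simp add: exp_add[symmetric] power2_eq_square)
    have "ennreal (1 - ?D / 2) = ennreal (\<integral>x. 1 - (f (Z x) (W x))\<^sup>2 / 2 \<partial>M)"
      using int by (simp add: prob_space)
    also have "\<dots> \<le> ennreal (\<integral>x. exp (- ((f (Z x) (W x))\<^sup>2 / 2)) \<partial>M)"
    proof (intro ennreal_leI integral_mono)
      show "integrable M (\<lambda>x. exp (- ((f (Z x) (W x))\<^sup>2 / 2)))"
        by (rule integrable_const_bound[where B = 1]) auto
      fix x
      show "1 - (f (Z x) (W x))\<^sup>2 / 2 \<le> exp (- ((f (Z x) (W x))\<^sup>2 / 2))"
        using exp_ge_add_one_self[of "- ((f (Z x) (W x))\<^sup>2 / 2)"] by simp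
    qed (use int in auto)
    also have "\<dots> = (\<integral>\<^sup>+x. ennreal (exp (- ((f (Z x) (W x))\<^sup>2 / 2))) \<partial>M)"
      by (intro nn_integral_eq_integral[symmetric] integrable_const_bound[where B = 1]) auto
    also have "\<dots> = (\<integral>\<^sup>+t. ?r t \<partial>?P)"
      using r pair.M2.emeasure_space_1 by (subst nn_integral_gauss_law) auto
    finally show "ennreal (1 - ?D / 2) \<le> (\<integral>\<^sup>+t. ?r t \<partial>?P)" .
  qed (use L[of 1] L[of "- 1"] r D \<open>n \<ge> 1\<close> est in auto)
qed

section \<open>Lower bound in one basis direction\<close>

lemma scaled_basis_in_ellipsoid:
  assumes e: "orthonormal_basis M Z e" and "j \<ge> 1" and c: "w j * s\<^sup>2 \<le> c"
  shows "(\<lambda>z. s * e j z) \<in> ellipsoid M Z e w c"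
proof -
  have ej: "e j \<in> L2 M Z" and ip: "\<And>i. inner_L2 M Z (e j) (e (Suc i)) = (if j = Suc i then 1 else 0)"
    using e \<open>j \<ge> 1\<close> by (auto simp: orthonormal_basis_def)
  then have "(\<lambda>z. s * e j z) \<in> L2 M Z"
    by (auto simp: L2_def power_mult_distrib)
  moreover have "wnorm_sq M Z e w (\<lambda>z. s * e j z) \<le> ennreal c"
  proof -
    have "inner_L2 M Z (\<lambda>z. s * e j z) (e (Suc i)) = s * (if j = Suc i then 1 else 0)" for i
      using ip[of i] by (simp add: inner_L2_def mult.assoc)
    then have "wnorm_sq M Z e w (\<lambda>z. s * e j z)
        = (\<Sum>i. if j = Suc i then ennreal (w (Suc i) * s\<^sup>2) else 0)"
      unfolding wnorm_sq_def by (intro suminf_cong) simp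
    also have "\<dots> = (\<Sum>i\<in>{j - 1}. if j = Suc i then ennreal (w (Suc i) * s\<^sup>2) else 0)"
      by (intro suminf_finite) auto
    also have "\<dots> = ennreal (w j * s\<^sup>2)"
      using \<open>j \<ge> 1\<close> by simp
    finally show ?thesis
      using c by (simp add: ennreal_leI)
  qed
  ultimately show ?thesis
    by (simp add: ellipsoid_def)
qed

text \<open>
  The two hypotheses \<open>\<phi> = \<plusminus> sqrt A * e j\<close> are paired with errors of opposite drift, and the larger of
  the two risks at the single functional \<open>h = sqrt B * e j\<close> is at least half of their sum. The
  assumptions on \<open>A\<close> and \<open>B\<close> say that \<open>\<phi>\<close> and \<open>h\<close> lie in their ellipsoids, that the error is
  admissible, and that the two laws of the sample remain close.
\<close>

lemma one_direction_minimax_bound: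
  fixes est :: "('b \<Rightarrow> real) \<Rightarrow> (nat \<Rightarrow> real \<times> 'b \<times> 'c) \<Rightarrow> real"
  assumes e: "orthonormal_basis M Z e" and "j \<ge> 1"
    and T: "cond_exp_operator M Z W T" "T \<in> op_class M Z W e \<upsilon> d" and "0 \<le> d"
    and fourth: "AE x in M. nn_cond_exp M (sigma_gen M W) (\<lambda>x. ennreal (e j (Z x) ^ 4)) x \<le> ennreal \<eta>"
    and "0 \<le> \<eta>" and \<sigma>: "27 * (2 * \<eta> + 3) \<le> \<sigma> ^ 4"
    and A: "0 \<le> A" "A \<le> 1" "\<gamma> j * A \<le> \<rho>" and B: "0 \<le> B" "\<omega> j * B \<le> \<tau>"
    and small: "real n * (d * \<upsilon> j * A) \<le> 1 / 2" and "0 \<le> \<upsilon> j" and "n \<ge> 1"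
    and est: "\<forall>h \<in> ellipsoid M Z e \<omega> \<tau>. est h \<in> estimators n"
  shows "ennreal (A * B / 2)
    \<le> (SUP Q \<in> error_laws M Z W \<sigma>. SUP \<phi> \<in> ellipsoid M Z e \<gamma> \<rho>. SUP h \<in> ellipsoid M Z e \<omega> \<tau>.
         risk n (obs_law Q \<phi>) (est h) (inner_L2 M Z h \<phi>))" (is "_ \<le> ?S")
proof -
  define g where "g = T (e j)"
  define h where "h = (\<lambda>z. sqrt B * e j z)"
  have ej: "e j \<in> L2 M Z" and ee: "inner_L2 M Z (e j) (e j) = 1"
    using e \<open>j \<ge> 1\<close> by (auto simp: orthonormal_basis_def)
  have ej_meas[measurable]: "e j \<in> borel_measurable borel"
    and ej2: "integrable M (\<lambda>x. (e j (Z x))\<^sup>2)"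
    using ej by (auto simp: L2_def)
  have "g \<in> L2 M W" and cond: "AE x in M. g (W x) = real_cond_exp M (sigma_gen M W) (\<lambda>x. e j (Z x)) x"
    using T(1) ej by (auto simp: g_def cond_exp_operator_def)
  then have g_meas[measurable]: "g \<in> borel_measurable borel"
    and g2: "integrable M (\<lambda>x. (g (W x))\<^sup>2)"
    by (auto simp: L2_def)
  have int_e: "integrable M (\<lambda>x. e j (Z x))" and int_g: "integrable M (\<lambda>x. g (W x))"
    using ej2 g2 by (auto intro: square_integrable_imp_integrable)
  have g_bound: "(\<integral>x. (g (W x))\<^sup>2 \<partial>M) \<le> d * \<upsilon> j"
  proof -
    have "(norm_L2 M W g)\<^sup>2 = (\<integral>x. (g (W x))\<^sup>2 \<partial>M)"
      by (simp add: norm_L2_def inner_L2_def power2_eq_square[symmetric])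
    moreover have "ennreal ((norm_L2 M W g)\<^sup>2) \<le> ennreal d * wnorm_sq M Z e \<upsilon> (e j)"
      using T(2) ej by (simp add: op_class_def g_def)
    moreover have "wnorm_sq M Z e \<upsilon> (e j) \<le> ennreal (\<upsilon> j)"
      using scaled_basis_in_ellipsoid[OF e \<open>j \<ge> 1\<close>, of \<upsilon> 1 "\<upsilon> j"] by (simp add: ellipsoid_def)
    ultimately have "ennreal (\<integral>x. (g (W x))\<^sup>2 \<partial>M) \<le> ennreal d * ennreal (\<upsilon> j)"
      by (metis mult_left_mono order_trans zero_le)
    then show ?thesis
      using \<open>0 \<le> d\<close> \<open>0 \<le> \<upsilon> j\<close> by (simp add: ennreal_mult[symmetric])
  qed
  have small': "real n * (\<integral>x. (sqrt A * g (W x))\<^sup>2 \<partial>M) \<le> 1 / 2"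
  proof -
    have "(\<integral>x. (sqrt A * g (W x))\<^sup>2 \<partial>M) = A * (\<integral>x. (g (W x))\<^sup>2 \<partial>M)"
      using A by (simp add: power_mult_distrib)
    also have "\<dots> \<le> A * (d * \<upsilon> j)"
      by (intro mult_left_mono g_bound A)
    finally have "real n * (\<integral>x. (sqrt A * g (W x))\<^sup>2 \<partial>M) \<le> real n * (A * (d * \<upsilon> j))"
      by (intro mult_left_mono) auto
    then show ?thesis
      using small by (simp add: mult_ac)
  qed
  have h: "h \<in> ellipsoid M Z e \<omega> \<tau>"
    unfolding h_def using B by (intro scaled_basis_in_ellipsoid e \<open>j \<ge> 1\<close>) simp
  have sg_meas: "case_prod (\<lambda>(z::'b) w. s * g w) \<in> borel_measurable borel" for s
  proof -
    note [measurable] = measurable_compose[OF borel_measurable_projections(2) g_meas]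
    show ?thesis
      unfolding split_beta' by measurable
  qed
  \<comment> \<open>The representer \<open>h\<close> is the same for both signs of \<open>s\<close>, so the same estimator faces both hypotheses.\<close>
  have member: "risk n (gauss_law M Z W (\<lambda>z w. s * g w)) (est h) (s * sqrt B) \<le> ?S"
    if s: "s\<^sup>2 = A" for s
  proof -
    let ?Q = "gauss_law M Z W (\<lambda>z w. s * (g w - e j z))"
    let ?\<phi> = "\<lambda>z. s * e j z"
    have "s ^ 4 = A\<^sup>2"
      by (simp add: s[symmetric] power_mult[symmetric])
    then have "s ^ 4 \<le> 1"
      using A by (simp add: power_le_one)
    then have Q: "?Q \<in> error_laws M Z W \<sigma>"
      by (intro gauss_law_error_law[OF ej_meas g_meas int_e int_g cond fourth \<open>0 \<le> \<eta>\<close> _ \<sigma>])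
    have \<phi>: "?\<phi> \<in> ellipsoid M Z e \<gamma> \<rho>"
      using A s by (intro scaled_basis_in_ellipsoid e \<open>j \<ge> 1\<close>) simp
    have "case_prod (\<lambda>z w. s * (g w - e j z)) \<in> borel_measurable borel"
    proof -
      note [measurable] = measurable_compose[OF borel_measurable_projections(1) ej_meas]
        measurable_compose[OF borel_measurable_projections(2) g_meas]
      show ?thesis
        unfolding split_beta' by measurable
    qed
    then have "obs_law ?Q ?\<phi> = gauss_law M Z W (\<lambda>z w. s * g w)"
      by (subst obs_law_gauss_law) (auto simp: algebra_simps)
    moreover have "inner_L2 M Z h ?\<phi> = s * sqrt B"
    proof -
      have "inner_L2 M Z h ?\<phi> = (\<integral>x. (s * sqrt B) * (e j (Z x) * e j (Z x)) \<partial>M)"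
        unfolding inner_L2_def h_def
        by (intro Bochner_Integration.integral_cong) (auto simp: mult_ac)
      then show ?thesis
        using ee by (simp add: inner_L2_def)
    qed
    ultimately have "risk n (gauss_law M Z W (\<lambda>z w. s * g w)) (est h) (s * sqrt B)
        = risk n (obs_law ?Q ?\<phi>) (est h) (inner_L2 M Z h ?\<phi>)"
      by simp
    also have "\<dots> \<le> ?S"
      by (intro SUP_upper2[OF Q] SUP_upper2[OF \<phi>] SUP_upper2[OF h] order_refl)
    finally show ?thesis .
  qed
  have "ennreal ((sqrt A * sqrt B)\<^sup>2)
      \<le> risk n (gauss_law M Z W (\<lambda>z w. sqrt A * g w)) (est h) (sqrt A * sqrt B)
        + risk n (gauss_law M Z W (\<lambda>z w. - (sqrt A * g w))) (est h) (- (sqrt A * sqrt B))"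
    using g2 small' est h \<open>n \<ge> 1\<close> sg_meas
    by (intro gauss_law_two_point_risk) (auto simp: power_mult_distrib)
  also have "\<dots> \<le> ?S + ?S"
    using member[of "sqrt A"] member[of "- sqrt A"] A by (intro add_mono) auto
  finally have "ennreal (A * B) \<le> ?S + ?S"
    using A B by (simp add: power_mult_distrib)
  moreover have "ennreal (x / 2) \<le> S" if "ennreal x \<le> S + S" for x S
    using that by (cases S) (auto simp: ennreal_plus[symmetric] ennreal_le_iff2 simp del: ennreal_plus)
  ultimately show ?thesis
    by blast
qed

end

section \<open>The minimax lower bound\<close>

theorem theorem2p1:
  fixes M :: "'a measure"
    and Z :: "'a \<Rightarrow> real ^ 'p" and W :: "'a \<Rightarrow> real ^ 'q"
    and e :: "nat \<Rightarrow> real ^ 'p \<Rightarrow> real"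
    and \<gamma> \<omega> \<upsilon> :: "nat \<Rightarrow> real"
    and \<rho> \<tau> d \<eta> :: real
    and T :: "(real ^ 'p \<Rightarrow> real) \<Rightarrow> (real ^ 'q \<Rightarrow> real)"
  assumes "prob_space M"
    and "Z \<in> borel_measurable M" and "W \<in> borel_measurable M"
    and "orthonormal_basis M Z e"
    and "regular_weights \<gamma> \<omega> \<upsilon>"
    and "\<rho> > 0" and "\<tau> > 0" and "d \<ge> 1" and "\<eta> \<ge> 1"
    and "cond_exp_operator M Z W T"
    and "T \<in> op_class M Z W e \<upsilon> d"
    and "AE x in M. (SUP j\<in>{1..}.
           nn_cond_exp M (sigma_gen M W) (\<lambda>x. ennreal (e j (Z x) ^ 4)) x) \<le> ennreal \<eta>"
  shows "\<exists>\<sigma>\<^sub>0>0. \<forall>\<sigma>\<ge>\<sigma>\<^sub>0. \<forall>n\<ge>1. \<forall>\<Delta>\<ge>1. \<forall>m\<ge>1. \<forall>\<delta>>0.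
     1 / \<Delta> \<le> \<gamma> m / (real n * \<upsilon> m) \<longrightarrow>
     \<gamma> m / (real n * \<upsilon> m) \<le> \<Delta> \<longrightarrow>
     \<delta> = inverse (\<gamma> m) * inverse (\<omega> m) \<longrightarrow>
     (\<forall>est :: (real ^ 'p \<Rightarrow> real) \<Rightarrow> (nat \<Rightarrow> real \<times> (real ^ 'p) \<times> (real ^ 'q)) \<Rightarrow> real.
        (\<forall>h \<in> ellipsoid M Z e \<omega> \<tau>. est h \<in> estimators n) \<longrightarrow>
        (SUP Q \<in> error_laws M Z W \<sigma>. SUP \<phi> \<in> ellipsoid M Z e \<gamma> \<rho>. SUP h \<in> ellipsoid M Z e \<omega> \<tau>.
           risk n (obs_law Q \<phi>) (est h) (inner_L2 M Z h \<phi>))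
        \<ge> ennreal (max \<delta> (1 / real n) * (\<tau> / (4 * \<Delta>)) * min (1 / (2 * d)) (\<rho> / \<Delta>)))"
proof -
  interpret random_pair M Z W
    using assms(1-3) by (simp add: random_pair_def random_pair_axioms_def)
  have fourth: "AE x in M. nn_cond_exp M (sigma_gen M W) (\<lambda>x. ennreal (e j (Z x) ^ 4)) x \<le> ennreal \<eta>"
    if "j \<ge> 1" for j
    using assms(12) by eventually_elim (rule order_trans[OF SUP_upper], use that in auto)
  have pos: "0 < \<gamma> j" "0 < \<omega> j" "0 < \<upsilon> j" if "j \<ge> 1" for j
    using assms(5) that by (auto simp: regular_weights_def)
  have one: "\<gamma> 1 = 1" "\<omega> 1 = 1" "\<upsilon> 1 = 1"
    using assms(5) by (auto simp: regular_weights_def)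
  have \<gamma>1: "1 \<le> \<gamma> j" if "j \<ge> 1" for j
    using assms(5) that by (auto simp: regular_weights_def dest!: mono_onD[of _ _ 1 j])
  define \<sigma>\<^sub>0 where "\<sigma>\<^sub>0 = 27 * (2 * \<eta> + 3)"
  have \<sigma>: "\<sigma>\<^sub>0 \<le> \<sigma> ^ 4" if "\<sigma>\<^sub>0 \<le> \<sigma>" for \<sigma>
  proof -
    have "1 \<le> \<sigma>"
      using that \<open>\<eta> \<ge> 1\<close> by (simp add: \<sigma>\<^sub>0_def)
    then show ?thesis
      using that self_le_power[of \<sigma> 4] by simp
  qed
  show ?thesis
  proof (intro exI[of _ \<sigma>\<^sub>0] conjI allI impI)
    show "0 < \<sigma>\<^sub>0"
      using \<open>\<eta> \<ge> 1\<close> by (simp add: \<sigma>\<^sub>0_def)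
    fix \<sigma> :: real and n :: nat and \<Delta> :: real and m :: nat and \<delta> :: real
      and est :: "(real ^ 'p \<Rightarrow> real) \<Rightarrow> (nat \<Rightarrow> real \<times> (real ^ 'p) \<times> (real ^ 'q)) \<Rightarrow> real"
    assume \<sigma>\<^sub>0: "\<sigma>\<^sub>0 \<le> \<sigma>" and n: "1 \<le> n" and \<Delta>: "1 \<le> \<Delta>" and m: "1 \<le> m"
      and lo: "1 / \<Delta> \<le> \<gamma> m / (real n * \<upsilon> m)"
      and \<delta>: "\<delta> = inverse (\<gamma> m) * inverse (\<omega> m)"
      and est: "\<forall>h \<in> ellipsoid M Z e \<omega> \<tau>. est h \<in> estimators n"
    define \<kappa> where "\<kappa> = min (1 / (2 * d)) (\<rho> / \<Delta>)"
    let ?S = "SUP Q \<in> error_laws M Z W \<sigma>. SUP \<phi> \<in> ellipsoid M Z e \<gamma> \<rho>. SUP h \<in> ellipsoid M Z e \<omega> \<tau>.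
           risk n (obs_law Q \<phi>) (est h) (inner_L2 M Z h \<phi>)"
    have \<kappa>0: "0 < \<kappa>"
      using \<open>\<rho> > 0\<close> \<Delta> \<open>d \<ge> 1\<close> by (simp add: \<kappa>_def)
    have \<kappa>d: "d * \<kappa> \<le> 1 / 2"
    proof -
      have "d * \<kappa> \<le> d * (1 / (2 * d))"
        using \<open>d \<ge> 1\<close> by (intro mult_left_mono) (auto simp: \<kappa>_def)
      then show ?thesis using \<open>d \<ge> 1\<close> by simp
    qed
    have \<kappa>1: "\<kappa> \<le> 1"
      using \<kappa>d \<kappa>0 \<open>d \<ge> 1\<close> mult_right_mono[of 1 d \<kappa>] by linarith
    have "\<kappa> * \<Delta> \<le> \<rho>"
      using \<Delta> by (simp add: \<kappa>_def min_def field_simps)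
    moreover have "\<kappa> / \<Delta> \<le> \<kappa>" and "\<kappa> \<le> \<kappa> * \<Delta>"
      using \<Delta> \<kappa>0 by (auto simp: divide_le_eq mult_le_cancel_left1)
    ultimately have \<kappa>\<rho>: "\<kappa> / \<Delta> \<le> \<rho>" and \<kappa>\<Delta>: "\<kappa> / \<Delta> \<le> \<kappa>"
      by auto
    (* The rate x is attained in direction j by phi and h with squared coefficients
       A = (kappa / Delta) * omega j * x and B = tau / omega j. The bound by 1 on x keeps phi in its
       ellipsoid, the bound by Delta keeps the two laws close. *)
    have direction: "ennreal (x * (\<tau> / (4 * \<Delta>)) * \<kappa>) \<le> ?S"
      if j: "j \<ge> 1" and x: "0 \<le> x" "\<gamma> j * (\<omega> j * x) \<le> 1" and y: "real n * (\<upsilon> j * (\<omega> j * x)) \<le> \<Delta>" for j x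
    proof -
      define A where "A = \<kappa> / \<Delta> * (\<omega> j * x)"
      define B where "B = \<tau> / \<omega> j"
      have \<omega>x: "0 \<le> \<omega> j * x" "\<omega> j * x \<le> 1"
      proof -
        show "0 \<le> \<omega> j * x" using x pos[OF j] by simp
        then have "1 * (\<omega> j * x) \<le> \<gamma> j * (\<omega> j * x)"
          by (intro mult_right_mono \<gamma>1 j)
        then show "\<omega> j * x \<le> 1" using x by simp
      qed
      have \<kappa>\<Delta>0: "0 \<le> \<kappa> / \<Delta>" using \<kappa>0 \<Delta> by simp
      have "ennreal (A * B / 2) \<le> ?S"
      proof (rule one_direction_minimax_bound[OF assms(4) j assms(10,11) _ fourth[OF j]])
        show "27 * (2 * \<eta> + 3) \<le> \<sigma> ^ 4"
          using \<sigma>[OF \<sigma>\<^sub>0] by (simp add: \<sigma>\<^sub>0_def)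
        show "0 \<le> A"
          unfolding A_def by (rule mult_nonneg_nonneg[OF \<kappa>\<Delta>0 \<omega>x(1)])
        show "A \<le> 1"
          unfolding A_def
          using mult_mono[OF order_trans[OF \<kappa>\<Delta> \<kappa>1] \<omega>x(2) zero_le_one \<omega>x(1)] by simp
        have "\<gamma> j * A = \<kappa> / \<Delta> * (\<gamma> j * (\<omega> j * x))"
          by (simp add: A_def)
        also have "\<dots> \<le> \<kappa> / \<Delta> * 1"
          by (intro mult_left_mono x \<kappa>\<Delta>0)
        finally show "\<gamma> j * A \<le> \<rho>"
          using \<kappa>\<rho> by simp
        have "real n * (d * \<upsilon> j * A) = d * (\<kappa> / \<Delta>) * (real n * (\<upsilon> j * (\<omega> j * x)))"
          by (simp add: A_def)
        also have "\<dots> \<le> d * (\<kappa> / \<Delta>) * \<Delta>"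
          using \<open>d \<ge> 1\<close> \<kappa>\<Delta>0 by (intro mult_left_mono y mult_nonneg_nonneg) auto
        also have "\<dots> = d * \<kappa>"
          using \<Delta> by simp
        finally show "real n * (d * \<upsilon> j * A) \<le> 1 / 2"
          using \<kappa>d by simp
      qed (use \<open>d \<ge> 1\<close> \<open>\<eta> \<ge> 1\<close> \<open>\<tau> > 0\<close> pos[OF j] n est in \<open>auto simp: B_def\<close>)
      moreover have "x * (\<tau> / (4 * \<Delta>)) * \<kappa> \<le> A * B / 2"
      proof -
        have "0 \<le> x * \<tau> * \<kappa> / \<Delta>"
          using x \<open>\<tau> > 0\<close> \<kappa>0 \<Delta> by simp
        moreover have "A * B = x * \<tau> * \<kappa> / \<Delta>"
          using pos[OF j] by (simp add: A_def B_def)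
        ultimately show ?thesis by (simp add: mult_ac)
      qed
      ultimately show ?thesis
        by (meson ennreal_leI order_trans)
    qed
    have "ennreal (\<delta> * (\<tau> / (4 * \<Delta>)) * \<kappa>) \<le> ?S"
    proof (rule direction[OF m])
      show "0 \<le> \<delta>" "\<gamma> m * (\<omega> m * \<delta>) \<le> 1"
        using pos[OF m] by (simp_all add: \<delta> field_simps)
      have "real n * \<upsilon> m \<le> \<Delta> * \<gamma> m"
        using lo pos[OF m] n \<Delta> by (simp add: field_simps)
      then show "real n * (\<upsilon> m * (\<omega> m * \<delta>)) \<le> \<Delta>"
        using pos[OF m] by (simp add: \<delta> field_simps)
    qed
    moreover have "ennreal (1 / real n * (\<tau> / (4 * \<Delta>)) * \<kappa>) \<le> ?S"
      using n \<Delta> by (intro direction[of 1]) (auto simp: one simp del: One_nat_def)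
    ultimately show "ennreal (max \<delta> (1 / real n) * (\<tau> / (4 * \<Delta>)) * min (1 / (2 * d)) (\<rho> / \<Delta>)) \<le> ?S"
      unfolding \<kappa>_def[symmetric] by (simp add: max_def)
  qed
qed

end
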